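(* Let $q$ be a prime power, let $n>1$ be an integer that is not a prime power, let $\delta(n)$ be the number of positive divisors of $n$, and let $1<k<\delta(n)$. Let $(d_1,\ldots,d_k)$ be a tuple of divisors of $n$ with $d_1<\cdots<d_k<n$ such that $d_i\nmid d_j$ whenever $i\ne j$. Let $(a_1,\ldots,a_k)$ with $a_i\in\mathbb{F}_{q^{d_i}}^*$ satisfy $N_{d_i/\gcd(d_i,d_j)}(a_i)=N_{d_j/\gcd(d_i,d_j)}(a_j)$ for all $1\le i<j\le k$. If $$\gcd\left(\frac{q^n-1}{q^{d_1}-1},\ldots,\frac{q^n-1}{q^{d_k}-1}\right)\ge W_q(x^n-1)\,q^{n/2},$$ then there exists $\alpha\in\mathbb{F}_{q^n}^*$ normal over $\mathbb{F}_q$ with $N_{n/d_i}(\alpha)=a_i$ for every $1\le i\le k$.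
   Context: For a divisor $d$ of $m$ and $\alpha\in\mathbb{F}_{q^m}^*$, $N_{m/d}(\alpha)=\alpha^{(q^m-1)/(q^d-1)}$ denotes the norm of $\alpha$ from $\mathbb{F}_{q^m}$ to $\mathbb{F}_{q^d}$. An element $\beta\in\mathbb{F}_{q^n}$ is normal over $\mathbb{F}_q$ if $\{\beta,\beta^q,\ldots,\beta^{q^{n-1}}\}$ is an $\mathbb{F}_q$-basis of $\mathbb{F}_{q^n}$. For $f\in\mathbb{F}_q[x]$, $W_q(f)$ denotes the number of monic squarefree divisors of $f$ in $\mathbb{F}_q[x]$. *)

theory Defs
  imports
    Complex_Main
    "HOL-Library.Cardinality"
    "HOL-Computational_Algebra.Computational_Algebra"
    "HOL-Number_Theory.Prime_Powers"
begin

definition field_embedding :: "('q::field \<Rightarrow> 'a::field) \<Rightarrow> bool" where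
  "field_embedding \<phi> \<longleftrightarrow>
     \<phi> 1 = 1 \<and> (\<forall>x y. \<phi> (x + y) = \<phi> x + \<phi> y) \<and> (\<forall>x y. \<phi> (x * y) = \<phi> x * \<phi> y)"

text \<open>
  The subfield with \<open>q\<^sup>d\<close> elements of a field with \<open>q\<^sup>n\<close> elements, where \<open>d\<close> divides \<open>n\<close>.
  The lemmas \<open>card_GF_sub\<close> and \<open>GF_sub_closed\<close> below confirm that it is one; a finite field has
  at most one subfield of each size.
\<close>
definition GF_sub :: "nat \<Rightarrow> nat \<Rightarrow> 'a::finite_field set" where
  "GF_sub q d = {x. x ^ (q ^ d) = x}"

definition ff_norm :: "nat \<Rightarrow> nat \<Rightarrow> nat \<Rightarrow> 'a::field \<Rightarrow> 'a" where
  "ff_norm q m d \<alpha> = \<alpha> ^ ((q ^ m - 1) div (q ^ d - 1))"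

text \<open>
  The field \<open>'a\<close> is a vector space over \<open>'q\<close> via the embedding \<open>\<phi>\<close>, with \<open>n\<close> its dimension.
\<close>
definition normal_over :: "('q::finite_field \<Rightarrow> 'a::finite_field) \<Rightarrow> nat \<Rightarrow> 'a \<Rightarrow> bool" where
  "normal_over \<phi> n \<beta> \<longleftrightarrow>
     (let scale = (\<lambda>c x. \<phi> c * x);
          B = {\<beta> ^ (CARD('q) ^ i) | i. i < n}
      in \<not> module.dependent scale B \<and> module.span scale B = UNIV)"

definition W_q :: "'q::finite_field poly \<Rightarrow> nat" where
  "W_q f = card {g. lead_coeff g = 1 \<and> squarefree g \<and> g dvd f}"

lemma vector_space_field_embedding:
  assumes "field_embedding \<phi>"
  shows "vector_space (\<lambda>c x. \<phi> c * x)"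
  using assms by unfold_locales (auto simp: field_embedding_def algebra_simps)

lemma GF_sub_closed:
  fixes x y :: "'a::finite_field"
  assumes "primepow q" and card: "CARD('a) = q ^ n"
    and x: "x \<in> GF_sub q d" and y: "y \<in> GF_sub q d"
  shows "0 \<in> (GF_sub q d :: 'a set)" "1 \<in> (GF_sub q d :: 'a set)"
    "x + y \<in> GF_sub q d" "- x \<in> GF_sub q d" "x * y \<in> GF_sub q d" "inverse x \<in> GF_sub q d"
proof -
  obtain p m where p: "prime p" "m > 0" "q = p ^ m"
    using assms(1) by (auto simp: primepow_def)
  have prime: "prime CHAR('a)" by simp
  have "(\<Sum>x\<in>UNIV. x) = (\<Sum>x\<in>UNIV. x + 1 :: 'a)"
    by (rule sum.reindex_bij_witness[of _ "\<lambda>x. x + 1" "\<lambda>x. x - 1"]) auto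
  hence "of_nat (CARD('a)) = (0 :: 'a)"
    by (simp add: sum.distrib)
  hence "CHAR('a) dvd p ^ (m * n)"
    using card p(3) by (simp only: of_nat_eq_0_iff_char_dvd power_mult)
  hence "CHAR('a) = p"
    using prime p(1) by (metis prime_dvd_power primes_dvd_imp_eq)
  hence q: "q ^ d = CHAR('a) ^ (m * d)"
    using p(3) by (simp add: power_mult)
  have add: "(u + v) ^ (q ^ d) = u ^ (q ^ d) + v ^ (q ^ d)" for u v :: 'a
    by (rule freshmans_dream'[OF prime q])
  have "q > 0" using p by (simp add: prime_gt_0_nat)
  show "0 \<in> (GF_sub q d :: 'a set)" "1 \<in> (GF_sub q d :: 'a set)"
    using \<open>q > 0\<close> by (auto simp: GF_sub_def)
  show "x + y \<in> GF_sub q d" using x y by (simp add: GF_sub_def add)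
  have "x + (- x) ^ (q ^ d) = 0"
    using add[of x "- x"] x \<open>q > 0\<close> by (simp add: GF_sub_def power_0_left)
  thus "- x \<in> GF_sub q d" by (simp add: GF_sub_def add_eq_0_iff)
  show "x * y \<in> GF_sub q d" using x y by (simp add: GF_sub_def power_mult_distrib)
  show "inverse x \<in> GF_sub q d" using x by (simp add: GF_sub_def power_inverse)
qed

lemma card_GF_sub:
  assumes card: "CARD('a::finite_field) = q ^ n" and "q > 1" "d dvd n" "d > 0" "n > 0"
  shows "card (GF_sub q d :: 'a set) = q ^ d"
proof -
  define P where "P = (\<lambda>k. monom 1 k - monom 1 1 :: 'a poly)"
  have root: "poly (P k) x = 0 \<longleftrightarrow> x ^ k = x" for k and x :: 'a
    by (auto simp: P_def poly_monom)
  have degP: "degree (P k) = k" if "k > 1" for k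
    unfolding P_def using that
    by (subst diff_conv_add_uminus, subst degree_add_eq_left) (auto simp: degree_monom_eq)
  have qd: "q ^ d > 1" "q ^ n > 1" using one_less_power[OF assms(2)] assms(4,5) by blast+
  have dvd: "q ^ d - 1 dvd q ^ n - 1"
  proof -
    obtain c where c: "n = d * c" using assms(3) by blast
    have "int (q ^ d) - 1 dvd int (q ^ d) ^ c - 1"
      by (metis dvd_triv_left power_diff_1_eq)
    hence "int (q ^ d - 1) dvd int (q ^ n - 1)"
      using qd by (simp add: c power_mult of_nat_diff)
    thus ?thesis by presburger
  qed
  obtain c where c: "q ^ n - 1 = (q ^ d - 1) * c" using dvd by blast
  have Pfac: "P (Suc k) = monom 1 1 * (monom 1 k - 1)" for k
    by (simp add: P_def algebra_simps mult_monom)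
  have "monom 1 (q ^ d - 1) - 1 dvd (monom 1 (q ^ d - 1) :: 'a poly) ^ c - 1"
    by (metis dvd_triv_left power_diff_1_eq)
  hence "monom 1 (q ^ d - 1) - 1 dvd (monom 1 (q ^ n - 1) :: 'a poly) - 1"
    by (simp only: c monom_power power_one mult.commute)
  hence "P (Suc (q ^ d - 1)) dvd P (Suc (q ^ n - 1))"
    unfolding Pfac by (rule mult_dvd_mono[OF dvd_refl])
  moreover have "Suc (q ^ d - 1) = q ^ d" "Suc (q ^ n - 1) = q ^ n" using qd by linarith+
  ultimately have "P (q ^ d) dvd P (q ^ n)" by simp
  then obtain Q where Q: "P (q ^ n) = P (q ^ d) * Q" by blast
  have nz: "P (q ^ n) \<noteq> 0" "P (q ^ d) \<noteq> 0" using degP[of "q ^ n"] degP[of "q ^ d"] qd \<open>q > 1\<close> by auto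
  hence Qnz: "Q \<noteq> 0" using Q by auto
  have deg: "q ^ n = q ^ d + degree Q"
    using degree_mult_eq[OF nz(2) Qnz] degP[OF qd(1)] degP[OF qd(2)] Q by metis
  have "poly (P (q ^ n)) x = 0" for x
    unfolding root using finite_field_power_card_eq_same[of x] card by simp
  hence "UNIV = {x. poly (P (q ^ d)) x = 0} \<union> {x. poly Q x = 0}"
    unfolding Q by auto
  hence "q ^ n \<le> card {x. poly (P (q ^ d)) x = 0} + card {x. poly Q x = 0}"
    using card by (metis card_Un_le)
  moreover have "card {x. poly Q x = 0} \<le> degree Q" by (rule card_poly_roots_bound[OF Qnz])
  moreover have "card {x. poly (P (q ^ d)) x = 0} \<le> q ^ d"
    using card_poly_roots_bound[OF nz(2)] degP[OF qd(1)] by simp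
  ultimately show ?thesis using deg by (simp add: GF_sub_def root)
qed

end

theory Submission
  imports Defs "HOL-Algebra.Multiplicative_Group" "HOL-Number_Theory.Pocklington"
begin

text \<open>
  Written as exponents of a generator of the multiplicative group, the norm conditions are congruences
  modulo \<open>q ^ d\<^sub>i - 1\<close>; they are compatible by hypothesis, so the solutions contain a coset \<open>c H\<close> of
  \<open>H = {h. h ^ G = 1}\<close>, where \<open>G\<close> is the gcd in the statement. For a nontrivial additive character,
  Parseval bounds its sum over \<open>c H\<close> by \<open>q powr (n / 2)\<close>.

  For an irreducible factor \<open>P\<close> of \<open>X ^ n - 1\<close> let \<open>U\<^sub>P\<close> be the kernel of \<open>P\<close> evaluated at the Frobenius
  map. An element \<open>x\<close> is normal as soon as, for every \<open>P\<close>, it is not orthogonal to \<open>U\<^sub>P\<close>, that is, as soon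
  as the product over \<open>P\<close> of \<open>1 - (\<Sum>b\<in>U\<^sub>P. \<psi> (b * x)) / card U\<^sub>P\<close> does not vanish. In the Fourier expansion of
  each factor the coefficients have absolute sum \<open>2 * (1 - 1 / card U\<^sub>P)\<close>, twice the constant coefficient.
  As the \<open>U\<^sub>P\<close> are independent, in the expansion of the product the nonconstant terms weigh at most
  \<open>W\<^sub>q (X ^ n - 1) - 1\<close> times the constant one, and hence cannot cancel its contribution to the sum over \<open>c H\<close>.
\<close>

hide_const (open) up_ring.monom up_ring.coeff Module.module.smult

section \<open>Additive characters\<close>

locale additive_character =
  fixes \<psi> :: "'a::finite_field \<Rightarrow> complex"
  assumes add: "\<psi> (x + y) = \<psi> x * \<psi> y"
    and norm_eq_1: "norm (\<psi> x) = 1"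
    and nontrivial: "\<exists>x. \<psi> x \<noteq> 1"
begin

lemma zero: "\<psi> 0 = 1"
proof -
  have "\<psi> 0 * \<psi> 0 = \<psi> 0 * 1" using add[of 0 0] by simp
  moreover have "\<psi> 0 \<noteq> 0" using norm_eq_1[of 0] by auto
  ultimately show ?thesis by (metis mult_left_cancel)
qed

lemma minus: "\<psi> (- x) = cnj (\<psi> x)"
proof -
  have "\<psi> x * \<psi> (- x) = \<psi> x * cnj (\<psi> x)"
    using add[of x "- x"] zero norm_eq_1[of x] by (simp add: complex_norm_square[symmetric])
  moreover have "\<psi> x \<noteq> 0" using norm_eq_1[of x] by auto
  ultimately show ?thesis by (metis mult_left_cancel)
qed

lemma sum_eq: "\<psi> (\<Sum>i\<in>I. f i) = (\<Prod>i\<in>I. \<psi> (f i))" if "finite I"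
  using that by induction (auto simp: zero add)

text \<open>Translating by some \<open>y\<close> with \<open>\<psi> (b * y) \<noteq> 1\<close>
  multiplies the sum by \<open>\<psi> (b * y)\<close>, so it must vanish.\<close>

lemma sum_over_subgroup:
  assumes sub: "\<And>x y. x \<in> V \<Longrightarrow> y \<in> V \<Longrightarrow> x - y \<in> V"
  shows "(\<Sum>x\<in>V. \<psi> (b * x)) = (if \<forall>x\<in>V. \<psi> (b * x) = 1 then of_nat (card V) else 0)"
proof (cases "\<forall>x\<in>V. \<psi> (b * x) = 1")
  case False
  then obtain y where y: "y \<in> V" "\<psi> (b * y) \<noteq> 1" by auto
  have "0 \<in> V" using sub[OF y(1) y(1)] by simp
  hence "- y \<in> V" using sub[of 0 y] y by simp
  hence "(\<Sum>x\<in>V. \<psi> (b * x)) = (\<Sum>x\<in>V. \<psi> (b * (x + y)))"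
    using sub sub[of _ "- y"] y(1)
    by (intro sum.reindex_bij_witness[of _ "\<lambda>x. x + y" "\<lambda>x. x - y"]) auto
  also have "\<dots> = \<psi> (b * y) * (\<Sum>x\<in>V. \<psi> (b * x))"
    by (simp add: distrib_left add sum_distrib_left mult.commute)
  finally have "(\<psi> (b * y) - 1) * (\<Sum>x\<in>V. \<psi> (b * x)) = 0"
    by (simp add: algebra_simps)
  thus ?thesis using y False by auto
qed auto

lemma sum_UNIV: "(\<Sum>x\<in>UNIV. \<psi> (b * x)) = (if b = 0 then of_nat CARD('a) else 0)"
proof (cases "b = 0")
  case False
  obtain x where "\<psi> x \<noteq> 1" using nontrivial by blast
  hence "\<psi> (b * (x / b)) \<noteq> 1" using False by simp
  hence "\<not> (\<forall>x\<in>UNIV. \<psi> (b * x) = 1)" by blast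
  thus ?thesis using False by (subst sum_over_subgroup) auto
qed (simp add: zero)

text \<open>Double counting: the sum over \<open>V\<close> and all \<open>b\<close> equals
  \<open>CARD('a)\<close>; were \<open>b = 0\<close> the only orthogonal element, it would equal
  \<open>card V\<close>.\<close>

lemma ex_orthogonal:
  assumes sub: "\<And>x y. x \<in> V \<Longrightarrow> y \<in> V \<Longrightarrow> x - y \<in> V" and "0 \<in> V" "V \<noteq> UNIV"
  shows "\<exists>b. b \<noteq> 0 \<and> (\<forall>x\<in>V. \<psi> (b * x) = 1)"
proof (rule ccontr)
  assume *: "\<not> ?thesis"
  have "(\<Sum>x\<in>V. \<Sum>b\<in>UNIV. \<psi> (b * x)) = (\<Sum>x\<in>V. if x = 0 then of_nat CARD('a) else 0)"
    using sum_UNIV by (simp add: mult.commute)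
  also have "\<dots> = of_nat CARD('a)" using assms(2) by simp
  finally have "(\<Sum>b\<in>UNIV. \<Sum>x\<in>V. \<psi> (b * x)) = of_nat CARD('a)"
    by (subst sum.swap)
  moreover have "(\<Sum>x\<in>V. \<psi> (b * x)) = (if b = 0 then of_nat (card V) else 0)" for b
    using * sum_over_subgroup[OF sub, of b] by (auto simp: zero)
  ultimately have "of_nat (card V) = (of_nat CARD('a) :: complex)" by simp
  hence "card V = CARD('a)" by (simp only: of_nat_eq_iff)
  thus False using assms(3) by (metis card_subset_eq finite top_greatest)
qed

text \<open>Parseval over all dilates \<open>c\<close>: the sum depends only on the coset of \<open>c\<close>, so each coset
  carries \<open>card H\<close> equal terms, which replaces the usual expansion into Gauss sums.\<close>
lemma norm_sum_coset_le:
  assumes "H \<noteq> {}" "0 \<notin> H" and mult: "\<And>x y. x \<in> H \<Longrightarrow> y \<in> H \<Longrightarrow> x * y \<in> H" and "c \<noteq> 0"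
  shows "norm (\<Sum>h\<in>H. \<psi> (c * h)) \<le> sqrt CARD('a)"
proof -
  define S where "S = (\<lambda>c. \<Sum>h\<in>H. \<psi> (c * h))"
  have SH: "S (c * h) = S c" if "h \<in> H" for h
  proof -
    have inj: "inj_on ((*) h) H" using that assms(2) by (auto simp: inj_on_def)
    hence "(*) h ` H = H" using mult[OF that] by (intro card_subset_eq) (auto simp: card_image)
    thus ?thesis unfolding S_def using sum.reindex[OF inj, of "\<lambda>h. \<psi> (c * h)"]
      by (simp add: mult.assoc)
  qed
  have "of_real (\<Sum>c\<in>UNIV. (norm (S c))\<^sup>2) = (\<Sum>c\<in>UNIV. S c * cnj (S c))"
    by (simp add: complex_norm_square[symmetric])
  also have "\<dots> = (\<Sum>c\<in>UNIV. \<Sum>h\<in>H. \<Sum>k\<in>H. \<psi> ((h - k) * c))"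
    unfolding S_def by (simp add: sum_product minus[symmetric] add[symmetric] algebra_simps)
  also have "\<dots> = (\<Sum>h\<in>H. \<Sum>k\<in>H. \<Sum>c\<in>UNIV. \<psi> ((h - k) * c))"
    by (subst sum.swap, rule sum.cong[OF refl], subst sum.swap) simp
  also have "\<dots> = (\<Sum>h\<in>H. \<Sum>k\<in>H. if h = k then of_nat CARD('a) else 0)"
    by (simp only: sum_UNIV right_minus_eq)
  also have "\<dots> = of_real (real (card H * CARD('a)))" by simp
  finally have total: "(\<Sum>c\<in>UNIV. (norm (S c))\<^sup>2) = real (card H * CARD('a))"
    by (simp only: of_real_eq_iff)
  have inj: "inj_on ((*) c) H" using assms(4) by (auto simp: inj_on_def)
  have "real (card H) * (norm (S c))\<^sup>2 = (\<Sum>x\<in>(*) c ` H. (norm (S x))\<^sup>2)"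
    by (simp add: sum.reindex[OF inj] SH)
  also have "\<dots> \<le> real (card H * CARD('a))"
    unfolding total[symmetric] by (intro sum_mono2) auto
  finally have "(norm (S c))\<^sup>2 \<le> CARD('a)"
    using assms(1) by (simp add: card_gt_0_iff)
  thus ?thesis unfolding S_def by (rule real_le_rsqrt)
qed

end

section \<open>The prime field and a character from the absolute trace\<close>

lemma CHAR_dvd_CARD: "CHAR('a::finite_field) dvd CARD('a)"
proof -
  have "(\<Sum>x\<in>UNIV. x) = (\<Sum>x\<in>UNIV. x + 1 :: 'a)"
    by (rule sum.reindex_bij_witness[of _ "\<lambda>x. x + 1" "\<lambda>x. x - 1"]) auto
  thus ?thesis by (simp add: sum.distrib of_nat_eq_0_iff_char_dvd[symmetric])
qed

text \<open>X^p - X has at most p roots, and the p distinct images of 0, ..., p - 1 already are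
  roots.\<close>

lemma ex_of_nat_if_power_CHAR_eq:
  fixes x :: "'a::finite_field"
  assumes "x ^ CHAR('a) = x"
  shows "\<exists>k. x = of_nat k"
proof -
  define p where "p = CHAR('a)"
  have p: "prime p" unfolding p_def by simp
  define P where "P = (monom 1 p - monom 1 1 :: 'a poly)"
  have "coeff P p = 1" using prime_gt_1_nat[OF p] by (simp add: P_def)
  hence "P \<noteq> 0" by auto
  have "degree P \<le> p" using prime_gt_1_nat[OF p] unfolding P_def
    by (intro degree_diff_le) (auto intro: order.trans[OF degree_monom_le])
  have roots: "(of_nat k :: 'a) ^ p = of_nat k" for k
  proof (induction k)
    case (Suc k)
    thus ?case using freshmans_dream[of p "1 :: 'a" "of_nat k"] p by (simp add: p_def)
  qed (use p in \<open>auto simp: prime_gt_0_nat\<close>)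
  have inj: "inj_on (of_nat :: nat \<Rightarrow> 'a) {..<p}"
    by (auto simp: inj_on_def of_nat_eq_iff_cong_CHAR p_def cong_def)
  have sub: "(of_nat :: nat \<Rightarrow> 'a) ` {..<p} \<subseteq> {x. poly P x = 0}"
    using roots by (auto simp: P_def poly_monom)
  have "card {x. poly P x = 0} \<le> p"
    using card_poly_roots_bound[OF \<open>P \<noteq> 0\<close>] \<open>degree P \<le> p\<close> by linarith
  hence "(of_nat :: nat \<Rightarrow> 'a) ` {..<p} = {x. poly P x = 0}"
    using card_image[OF inj] sub by (intro card_seteq) auto
  moreover have "x \<in> {x. poly P x = 0}" using assms by (simp add: P_def poly_monom p_def)
  ultimately show ?thesis by blast
qed

text \<open>The character is \<open>exp (2 \<pi> i Tr x / p)\<close> for the absolute trace \<open>Tr\<close>.\<close>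
lemma ex_frobenius_invariant_character:
  assumes card: "CARD('a::finite_field) = q ^ n" and q: "primepow q"
  shows "\<exists>\<psi> :: 'a \<Rightarrow> complex. additive_character \<psi> \<and> (\<forall>x. \<psi> (x ^ q) = \<psi> x)"
proof -
  define p where "p = CHAR('a)"
  have p: "prime p" unfolding p_def by simp
  obtain r m where r: "prime r" "m > 0" "q = r ^ m"
    using q by (auto simp: primepow_def)
  have "p dvd r ^ (m * n)" using CHAR_dvd_CARD[where 'a='a] card r(3) by (simp add: p_def power_mult)
  hence "p = r" using p r(1) by (metis prime_dvd_power primes_dvd_imp_eq)
  define N where "N = m * n"
  have cardN: "CARD('a) = p ^ N" using card r(3) \<open>p = r\<close> by (simp add: N_def power_mult)
  have "N > 0"
  proof (rule ccontr)
    assume "\<not> N > 0"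
    hence "CARD('a) = 1" using cardN by simp
    then obtain x :: 'a where "UNIV = {x}" by (auto simp: card_1_singleton_iff)
    hence "(0 :: 'a) = 1" by (metis UNIV_I singletonD)
    thus False by simp
  qed
  define Tr where "Tr = (\<lambda>x::'a. \<Sum>j<N. x ^ (p ^ j))"
  have fr: "(x + y) ^ (p ^ j) = x ^ (p ^ j) + y ^ (p ^ j)" for x y :: 'a and j
    by (rule freshmans_dream') (auto simp: p_def)
  have Tr_add: "Tr (x + y) = Tr x + Tr y" for x y
    by (simp add: Tr_def fr sum.distrib)
  have "(\<Sum>j<N. x ^ (p ^ Suc j)) = Tr x" for x
  proof -
    \<comment> \<open>The shifted sum trades the term at 0 for the term at \<open>N\<close>, and
      these agree since \<open>x ^ (p ^ N) = x\<close>. So the trace is invariant under p-th powers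
      of its argument and of itself.\<close>
    have "(\<Sum>j<M. f (Suc j)) + f 0 = (\<Sum>j<M. f j) + f M" for f :: "nat \<Rightarrow> 'a" and M
      by (induction M) (simp_all add: algebra_simps)
    from this[of "\<lambda>j. x ^ (p ^ j)" N]
    show ?thesis using finite_field_power_card_eq_same[of x] cardN by (simp add: Tr_def)
  qed
  note shift = this
  have Tr_p: "Tr (x ^ p) = Tr x" for x
    using shift[of x] by (simp add: Tr_def power_mult[symmetric] mult.commute)
  have Tr_pow: "Tr x ^ p = Tr x" for x
  proof -
    have "Tr x ^ p = (\<Sum>j<N. (x ^ (p ^ j)) ^ p)"
      unfolding Tr_def p_def by (rule freshmans_dream_sum) auto
    thus ?thesis using shift[of x] by (simp add: power_mult[symmetric] mult.commute)
  qed
  have Tr_q: "Tr (x ^ q) = Tr x" for x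
  proof -
    have "Tr (x ^ (p ^ k)) = Tr x" for k
    proof (induction k)
      case (Suc k)
      thus ?case using Tr_p[of "x ^ (p ^ k)"] by (simp add: power_mult[symmetric] mult.commute)
    qed simp
    thus ?thesis using r \<open>p = r\<close> by simp
  qed
  \<comment> \<open>The trace is a polynomial function with coefficient 1 at X and degree below the
    size of the field, so it cannot vanish everywhere.\<close>
  define P where "P = (\<Sum>j<N. monom 1 (p ^ j) :: 'a poly)"
  have poly_P: "poly P x = Tr x" for x by (simp add: P_def Tr_def poly_sum poly_monom)
  have "coeff P (p ^ 0) = (\<Sum>j<N. if j = 0 then 1 else 0)"
    unfolding P_def coeff_sum using prime_gt_1_nat[OF p] by (intro sum.cong) auto
  hence "P \<noteq> 0" using \<open>N > 0\<close> by auto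
  have "degree P \<le> p ^ (N - 1)" unfolding P_def using prime_gt_1_nat[OF p]
    by (intro degree_sum_le) (auto intro!: order.trans[OF degree_monom_le] power_increasing)
  also have "\<dots> < CARD('a)" unfolding cardN using prime_gt_1_nat[OF p] \<open>N > 0\<close>
    by (intro power_strict_increasing) auto
  finally have "card {x. poly P x = 0} < CARD('a)"
    using card_poly_roots_bound[OF \<open>P \<noteq> 0\<close>] by linarith
  then obtain y where y: "Tr y \<noteq> 0"
    using poly_P by (metis (mono_tags, lifting) Collect_cong UNIV_def less_irrefl)
  \<comment> \<open>\<open>Tr x\<close> is fixed by p-th powers, hence lies in the prime field. The
    choice of \<open>k x\<close> matters only modulo \<open>p\<close>, which is all that
    \<open>e\<close> sees.\<close>
  define k where "k = (\<lambda>x. SOME k. Tr x = of_nat k)"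
  have k: "Tr x = of_nat (k x)" for x
    unfolding k_def using someI_ex[OF ex_of_nat_if_power_CHAR_eq] Tr_pow[of x] p_def by blast
  define e where "e = (\<lambda>j::nat. cis (2 * pi * j / p))"
  have e_add: "e (i + j) = e i * e j" for i j
    by (simp add: e_def cis_mult[symmetric] add_divide_distrib distrib_left)
  have e_eq: "e i = e j \<longleftrightarrow> [i = j] (mod p)" for i j
  proof -
    have "e i = e j \<longleftrightarrow> cis (2 * pi * (real i - real j) / p) = 1"
    proof -
      have "cis (2 * pi * (real i - real j) / p) = e i / e j"
        by (simp add: e_def cis_divide[symmetric] diff_divide_distrib right_diff_distrib)
      moreover have "e j \<noteq> 0" by (simp add: e_def)
      ultimately show ?thesis by simp
    qed
    also have "\<dots> \<longleftrightarrow> (\<exists>t::int. 2 * pi * (real i - real j) / p = of_int t * (2 * pi))"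
      using cos_one_2pi_int cos_one_sin_zero by (auto simp: complex_eq_iff mult_ac)
    also have "\<dots> \<longleftrightarrow> (\<exists>t::int. real i - real j = of_int t * p)"
    proof (intro ex_cong1)
      fix t :: int
      have "2 * pi * (real i - real j) / p - of_int t * (2 * pi) =
          (2 * pi / p) * ((real i - real j) - of_int t * p)"
        using prime_gt_0_nat[OF p] by (simp add: field_simps)
      moreover have "2 * pi / p \<noteq> 0" using prime_gt_0_nat[OF p] by simp
      ultimately show "2 * pi * (real i - real j) / p = of_int t * (2 * pi) \<longleftrightarrow>
          real i - real j = of_int t * p"
        by (metis eq_iff_diff_eq_0 mult_eq_0_iff)
    qed
    also have "\<dots> \<longleftrightarrow> (\<exists>t::int. int i - int j = t * p)"
    proof (intro ex_cong1)
      fix t :: int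
      have "(real i - real j = of_int t * p) \<longleftrightarrow> real_of_int (int i - int j) = real_of_int (t * p)"
        by simp
      thus "(real i - real j = of_int t * p) \<longleftrightarrow> int i - int j = t * p"
        by (simp only: of_int_eq_iff)
    qed
    also have "\<dots> \<longleftrightarrow> [int i = int j] (mod int p)"
      by (auto simp: cong_iff_dvd_diff dvd_def mult.commute)
    finally show ?thesis by (simp add: cong_int_iff)
  qed
  have e_k: "e (k x) = e j \<longleftrightarrow> Tr x = of_nat j" for x j
    by (simp add: e_eq k of_nat_eq_iff_cong_CHAR p_def)
  show ?thesis
  proof (intro exI conjI allI)
    show "additive_character (\<lambda>x. e (k x))"
    proof
      show "e (k (x + y)) = e (k x) * e (k y)" for x y
      proof -
        have "Tr (x + y) = of_nat (k x + k y)" using Tr_add[of x y] k[of x] k[of y] by simp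
        thus ?thesis using e_k[of "x + y" "k x + k y"] e_add by simp
      qed
      show "norm (e (k x)) = 1" for x by (simp add: e_def)
      have "e (k y) \<noteq> e 0" using e_k[of y 0] y by simp
      thus "\<exists>x. e (k x) \<noteq> 1" by (auto simp: e_def)
    qed
    show "e (k (x ^ q)) = e (k x)" for x using e_k[of "x ^ q" "k x"] Tr_q[of x] k[of x] by simp
  qed
qed

section \<open>Elements with prescribed norms\<close>

lemma ex_generator:
  "\<exists>g::'a::finite_field. g \<noteq> 0 \<and> (\<forall>x. x \<noteq> 0 \<longrightarrow> (\<exists>i. x = g ^ i)) \<and>
     (\<forall>i j. g ^ i = g ^ j \<longleftrightarrow> [i = j] (mod (CARD('a) - 1)))"
proof -
  define R :: "'a ring" where "R = \<lparr>carrier = (UNIV :: 'a set), monoid.mult = (*), one = 1, ring.zero = 0, add = (+)\<rparr>"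
  have inv: "\<exists>y. x * y = 1" if "x \<noteq> 0" for x :: 'a
    using that by (intro exI[of _ "inverse x"]) simp
  have neg: "\<exists>y. x + y = 0" for x :: 'a by (rule exI[of _ "- x"]) simp
  interpret R: field R
    unfolding R_def using inv neg by unfold_locales (auto simp: algebra_simps Units_def)
  have pow: "x [^]\<^bsub>R\<^esub> i = x ^ i" for x and i :: nat
    by (induction i) (auto simp: R_def nat_pow_def)
  obtain g where g: "g \<in> carrier (mult_of R)" "carrier (mult_of R) = {g [^]\<^bsub>R\<^esub> i | i::nat. i \<in> UNIV}"
    using R.finite_field_mult_group_has_gen by (auto simp: R_def)
  have g0: "g \<noteq> 0" using g(1) by (simp add: R_def)
  have gen: "\<exists>i. x = g ^ i" if "x \<noteq> 0" for x
  proof -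
    have "x \<in> carrier (mult_of R)" using that by (simp add: R_def)
    thus ?thesis unfolding g(2) pow by blast
  qed
  define M where "M = CARD('a) - 1"
  have "card {0, 1 :: 'a} \<le> CARD('a)" by (rule card_mono) auto
  hence M: "M > 0" "CARD('a) = Suc M" by (auto simp: M_def)
  have gM: "g ^ M = 1"
    using finite_field_power_card_eq_same[of g] g0 M by simp
  have gmod: "g ^ i = g ^ (i mod M)" for i
    by (metis gM div_mult_mod_eq mult.commute mult_1 power_add power_mult power_one)
  \<comment> \<open>The exponents below \<open>M\<close> already reach all \<open>M\<close> nonzero
    elements, so no two of them give the same power.\<close>
  have "UNIV - {0} \<subseteq> (\<lambda>i. g ^ i) ` {..<M}"
  proof
    fix x :: 'a assume "x \<in> UNIV - {0}"
    then obtain i where "x = g ^ i" using gen by auto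
    hence "x = g ^ (i mod M)" using gmod by simp
    thus "x \<in> (\<lambda>i. g ^ i) ` {..<M}" using M by auto
  qed
  hence "card (UNIV - {0 :: 'a}) \<le> card ((\<lambda>i. g ^ i) ` {..<M})" by (intro card_mono) auto
  hence "card ((\<lambda>i. g ^ i) ` {..<M}) = card {..<M}"
    using card_image_le[of "{..<M}" "\<lambda>i. g ^ i"] by (simp add: M_def)
  hence inj: "inj_on (\<lambda>i. g ^ i) {..<M}" by (rule eq_card_imp_inj_on[rotated]) simp
  have "g ^ i = g ^ j \<longleftrightarrow> [i = j] (mod M)" for i j
  proof -
    have "g ^ i = g ^ j \<longleftrightarrow> g ^ (i mod M) = g ^ (j mod M)" using gmod by metis
    also have "\<dots> \<longleftrightarrow> i mod M = j mod M"
      using inj_on_eq_iff[OF inj, of "i mod M" "j mod M"] M by simp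
    finally show ?thesis by (simp add: cong_def)
  qed
  thus ?thesis using g0 gen unfolding M_def by blast
qed

section \<open>Simultaneous congruences for non-coprime moduli\<close>

lemma gcd_Lcm_dvd:
  fixes m :: "'i \<Rightarrow> int"
  assumes "finite I" "\<And>i. i \<in> I \<Longrightarrow> gcd (m i) c dvd z"
  shows "gcd (Lcm (m ` I)) c dvd z"
  using assms
proof (induction I rule: finite_induct)
  case (insert i I)
  have "gcd (Lcm (m ` insert i I)) c = lcm (gcd c (m i)) (gcd c (Lcm (m ` I)))"
    by (simp add: gcd.commute[of _ c] gcd_lcm_distrib)
  thus ?case using insert by (simp add: gcd.commute)
qed simp

text \<open>Induction: a solution for the old moduli may be changed by multiples of their lcm
  \<open>L\<close>. As gcd distributes over lcm, \<open>gcd L (m j)\<close> divides the discrepancy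
  \<open>x - b j\<close>, and Bezout gives the multiple of \<open>L\<close> to subtract.\<close>

lemma chinese_remainder_compatible:
  fixes m b :: "'i \<Rightarrow> int"
  assumes "finite I" "\<And>i j. i \<in> I \<Longrightarrow> j \<in> I \<Longrightarrow> [b i = b j] (mod gcd (m i) (m j))"
  shows "\<exists>x. \<forall>i\<in>I. [x = b i] (mod m i)"
  using assms
proof (induction I rule: finite_induct)
  case (insert j I)
  obtain x where x: "\<forall>i\<in>I. [x = b i] (mod m i)" using insert by auto
  define L where "L = Lcm (m ` I)"
  have "gcd (m i) (m j) dvd x - b j" if "i \<in> I" for i
  proof -
    have "[x = b i] (mod gcd (m i) (m j))" using x that cong_dvd_modulus by blast
    moreover have "[b i = b j] (mod gcd (m i) (m j))" using insert that by auto
    ultimately show ?thesis using cong_trans cong_iff_dvd_diff by blast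
  qed
  hence "gcd L (m j) dvd x - b j" unfolding L_def using insert.hyps by (intro gcd_Lcm_dvd) auto
  moreover obtain u v where "u * L + v * m j = gcd L (m j)" using bezout_int by blast
  ultimately obtain t where t: "x - b j = (u * L + v * m j) * t" by (metis dvdE)
  have "[x - t * u * L = b i] (mod m i)" if "i \<in> insert j I" for i
  proof (cases "i \<in> I")
    case True
    hence "m i dvd t * u * L" by (auto simp: L_def)
    hence "[x - t * u * L = x - 0] (mod m i)"
      by (intro cong_diff) (auto simp: cong_0_iff)
    thus ?thesis using x True by (metis cong_trans diff_zero)
  next
    case False
    have "x - t * u * L - b j = m j * (v * t)" using t by (simp add: algebra_simps)
    thus ?thesis using that False by (simp add: cong_iff_dvd_diff)
  qed
  thus ?case by blast
qed simp

lemma power_minus_1_dvd: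
  assumes "a dvd b" "q > 0"
  shows "(q :: nat) ^ a - 1 dvd q ^ b - 1"
proof -
  obtain c where c: "b = a * c" using assms by blast
  have "[(q ^ a) ^ c = 1 ^ c] (mod (q ^ a - 1))"
    using assms by (intro cong_pow) (simp add: cong_altdef_nat)
  thus ?thesis using cong_to_1_nat by (simp add: c power_mult)
qed

text \<open>Modulo the left-hand gcd both \<open>q ^ a\<close> and \<open>q ^ b\<close> are 1, so
  the order of \<open>q\<close> divides \<open>a\<close> and \<open>b\<close>, hence
  \<open>gcd a b\<close>.\<close>

lemma gcd_power_minus_1_dvd:
  assumes "q > 0"
  shows "gcd ((q :: nat) ^ a - 1) (q ^ b - 1) dvd q ^ gcd a b - 1"
proof -
  let ?t = "gcd (q ^ a - 1) (q ^ b - 1)"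
  have "[q ^ a = 1] (mod ?t)" "[q ^ b = 1] (mod ?t)"
    using assms by (simp_all add: cong_altdef_nat)
  hence "[q ^ gcd a b = 1] (mod ?t)" unfolding ord_divides by (rule gcd_greatest)
  thus ?thesis by (rule cong_to_1_nat)
qed

text \<open>On exponents with respect to a generator, prescribing \<open>N\<^bsub>n/d\<^esub>\<close> means prescribing the
  exponent modulo \<open>q ^ d - 1\<close>.\<close>
lemma ex_prescribed_norms:
  fixes a :: "'i \<Rightarrow> 'a::finite_field"
  assumes card: "CARD('a) = q ^ n" and "q > 1" "n > 0" "finite I"
    and d: "\<And>i. i \<in> I \<Longrightarrow> d i dvd n"
    and a: "\<And>i. i \<in> I \<Longrightarrow> a i \<in> GF_sub q (d i) - {0}"
    and compat: "\<And>i j. i \<in> I \<Longrightarrow> j \<in> I \<Longrightarrow>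
      ff_norm q (d i) (gcd (d i) (d j)) (a i) = ff_norm q (d j) (gcd (d i) (d j)) (a j)"
  shows "\<exists>\<alpha>::'a. \<alpha> \<noteq> 0 \<and> (\<forall>i\<in>I. ff_norm q n (d i) \<alpha> = a i)"
proof -
  define M where "M = q ^ n - 1"
  \<comment> \<open>For \<open>t\<close> dividing \<open>n\<close>, \<open>e t\<close> is the
    exponent of the norm to the subfield of size \<open>q ^ t\<close>, and \<open>g ^ e t\<close>
    generates the multiplicative group of that subfield.\<close>
  define e where "e = (\<lambda>t. M div (q ^ t - 1))"
  obtain g :: 'a where g: "g \<noteq> 0" "\<And>x. x \<noteq> 0 \<Longrightarrow> \<exists>i. x = g ^ i"
    "\<And>i j. g ^ i = g ^ j \<longleftrightarrow> [i = j] (mod M)"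
    using ex_generator[where 'a='a] unfolding card M_def by blast
  have pos: "t > 0" "q ^ t - 1 > 0" if "t dvd n" for t
  proof -
    show "t > 0" using that assms(3) by (rule dvd_pos_nat[rotated])
    thus "q ^ t - 1 > 0" using one_less_power[OF assms(2), of t] by simp
  qed
  have e: "M = e t * (q ^ t - 1)" if "t dvd n" for t
    using power_minus_1_dvd[OF that] assms(2) by (simp add: e_def M_def)
  have "M > 0" using pos[of n] by (simp add: M_def)
  \<comment> \<open>Membership in the subfield says that \<open>M\<close> divides the exponent of
    \<open>a i\<close> times \<open>q ^ d i - 1\<close>, so that exponent is a multiple of
    \<open>e (d i)\<close>.\<close>
  have "\<exists>b. a i = g ^ (e (d i) * b)" if i: "i \<in> I" for i
  proof -
    obtain A where A: "a i = g ^ A" using g(2) a[OF i] by blast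
    have "g ^ (A * q ^ d i) = g ^ A"
      using a[OF i] A by (simp add: GF_sub_def power_mult)
    hence "[int (A * q ^ d i) = int A] (mod int M)" unfolding g(3) cong_int_iff .
    hence "int M dvd int A * (int (q ^ d i) - 1)"
      by (simp add: cong_iff_dvd_diff algebra_simps)
    also have "int (q ^ d i) - 1 = int (q ^ d i - 1)"
      using pos[OF d[OF i]] by (simp add: of_nat_diff)
    finally have "M dvd A * (q ^ d i - 1)" by (metis of_nat_dvd_iff of_nat_mult)
    hence "e (d i) * (q ^ d i - 1) dvd A * (q ^ d i - 1)" using e[OF d[OF i]] by simp
    hence "e (d i) dvd A" using pos[OF d[OF i]] by simp
    thus ?thesis using A by blast
  qed
  then obtain b where b: "\<And>i. i \<in> I \<Longrightarrow> a i = g ^ (e (d i) * b i)" by metis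
  have "[int (b i) = int (b j)] (mod gcd (int (q ^ d i - 1)) (int (q ^ d j - 1)))"
    if ij: "i \<in> I" "j \<in> I" for i j
  proof -
    define t where "t = gcd (d i) (d j)"
    have t: "t dvd d i" "t dvd d j" "t dvd n" using d[OF ij(1)] by (auto simp: t_def)
    \<comment> \<open>Since \<open>e t = e (d l) * h\<close>, taking the norm keeps the number
      \<open>b l\<close> and only coarsens its modulus to \<open>q ^ t - 1\<close>.\<close>
    have norm: "ff_norm q (d l) t (a l) = g ^ (e t * b l)" if l: "l \<in> I" "t dvd d l" for l
    proof -
      define h where "h = (q ^ d l - 1) div (q ^ t - 1)"
      have h: "q ^ d l - 1 = h * (q ^ t - 1)"
        using power_minus_1_dvd[OF l(2)] assms(2) by (simp add: h_def)
      have "e t * (q ^ t - 1) = e (d l) * h * (q ^ t - 1)"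
        using e[OF t(3)] e[OF d[OF l(1)]] h by (metis mult.assoc)
      hence "e t = e (d l) * h" using pos[OF t(3)] by simp
      thus ?thesis by (simp add: ff_norm_def b[OF l(1)] h_def power_mult[symmetric] mult_ac)
    qed
    have "g ^ (e t * b i) = g ^ (e t * b j)"
      using compat[OF ij] norm[OF ij(1) t(1)] norm[OF ij(2) t(2)] by (simp add: t_def)
    hence "[e t * b i = e t * b j] (mod e t * (q ^ t - 1))" using g(3) e[OF t(3)] by simp
    hence "[b i = b j] (mod (q ^ t - 1))"
      using \<open>M > 0\<close> e[OF t(3)] by (auto simp: cong_def mult_mod_right[symmetric])
    hence "[b i = b j] (mod gcd (q ^ d i - 1) (q ^ d j - 1))"
      using cong_dvd_modulus_nat gcd_power_minus_1_dvd[of q "d i" "d j"] assms(2)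
      by (auto simp: t_def)
    thus ?thesis by (simp only: cong_int_iff gcd_int_int_eq)
  qed
  then obtain x where x: "\<And>i. i \<in> I \<Longrightarrow> [x = int (b i)] (mod int (q ^ d i - 1))"
    using chinese_remainder_compatible[OF \<open>finite I\<close>, of "\<lambda>i. int (b i)" "\<lambda>i. int (q ^ d i - 1)"]
    by blast
  \<comment> \<open>\<open>x\<close> may be negative; reducing it modulo \<open>M\<close> is
    harmless because each \<open>q ^ d i - 1\<close> divides \<open>M\<close>.\<close>
  define y where "y = nat (x mod int M)"
  have "int y = x mod int M" using \<open>M > 0\<close> by (simp add: y_def)
  hence y: "[int y = x] (mod int M)" by (simp add: cong_def)
  have "ff_norm q n (d i) (g ^ y) = a i" if i: "i \<in> I" for i
  proof -
    have "int (q ^ d i - 1) dvd int M"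
      using e[OF d[OF i]] by (metis dvd_triv_right of_nat_dvd_iff)
    hence "[int y = int (b i)] (mod int (q ^ d i - 1))"
      using cong_dvd_modulus[OF y] cong_trans[OF _ x[OF i]] by blast
    hence "[y = b i] (mod (q ^ d i - 1))" by (simp only: cong_int_iff)
    hence "[e (d i) * y = e (d i) * b i] (mod M)"
      using e[OF d[OF i]] by (metis cong_cmult_leftI)
    hence "g ^ (e (d i) * y) = a i" using g(3) b[OF i] by simp
    thus ?thesis by (simp add: ff_norm_def e_def M_def power_mult[symmetric] mult.commute)
  qed
  thus ?thesis using g(1) by (intro exI[of _ "g ^ y"]) auto
qed

lemma card_roots_of_unity_ge:
  assumes "G dvd CARD('a::finite_field) - 1" "G > 0"
  shows "card {h::'a. h ^ G = 1} \<ge> G"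
proof -
  obtain g :: 'a where g: "g \<noteq> 0"
    "\<And>i j. g ^ i = g ^ j \<longleftrightarrow> [i = j] (mod (CARD('a) - 1))"
    using ex_generator[where 'a='a] by blast
  obtain r where r: "CARD('a) - 1 = G * r" using assms by blast
  have "card {0, 1 :: 'a} \<le> CARD('a)" by (rule card_mono) auto
  hence "r > 0" using r by (cases r) auto
  have "inj_on (\<lambda>j. g ^ (r * j)) {..<G}"
  proof
    fix i j assume ij: "i \<in> {..<G}" "j \<in> {..<G}" "g ^ (r * i) = g ^ (r * j)"
    have "[r * i = r * j] (mod r * G)" using ij(3) unfolding g(2) r by (simp only: mult.commute)
    hence "r * (i mod G) = r * (j mod G)" unfolding cong_def mult_mod_right .
    thus "i = j" using ij \<open>r > 0\<close> by simp
  qed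
  moreover have "g ^ (r * j) \<in> {h. h ^ G = 1}" for j
    using g(2)[of "r * j * G" 0] unfolding r by (simp add: power_mult[symmetric] cong_def mult_ac)
  ultimately have "card {..<G} \<le> card {h::'a. h ^ G = 1}" by (intro card_inj_on_le) auto
  thus ?thesis by simp
qed

section \<open>Polynomials in the Frobenius map\<close>

lemma finite_polys_degree_le: "finite {f :: 'q::{finite, zero} poly. degree f \<le> m}"
proof (rule finite_subset)
  show "{f :: 'q poly. degree f \<le> m} \<subseteq> Poly ` {xs. set xs \<subseteq> UNIV \<and> length xs \<le> Suc m}"
  proof
    fix f :: "'q poly" assume "f \<in> {f. degree f \<le> m}"
    hence "length (coeffs f) \<le> Suc m" by (cases "f = 0") (auto simp: length_coeffs_degree)
    thus "f \<in> Poly ` {xs. set xs \<subseteq> UNIV \<and> length xs \<le> Suc m}"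
      by (intro image_eqI[of _ _ "coeffs f"]) auto
  qed
qed (intro finite_imageI finite_lists_length_le finite)

section \<open>Monic primes and squarefree divisors\<close>

lemma monic_irreducible_dvd_imp_eq:
  fixes P Q :: "'q::field poly"
  assumes "irreducible P" "irreducible Q" "lead_coeff P = 1" "lead_coeff Q = 1" "P dvd Q"
  shows "P = Q"
proof -
  obtain c where c: "Q = P * c" using assms(5) by blast
  have "c dvd 1" using irreducibleD[OF assms(2) c] irreducible_not_unit[OF assms(1)] by blast
  then obtain u where u: "c = [:u:]" by (auto simp: is_unit_poly_iff)
  have Q: "Q = smult u P" by (simp add: c u)
  hence "lead_coeff Q = u * lead_coeff P" by (simp only: lead_coeff_smult)
  hence "u = 1" using assms(3,4) by simp
  thus ?thesis using Q by simp
qed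

lemma prime_elem_dvd_prod:
  fixes p :: "'r::comm_semiring_1"
  assumes "prime_elem p" "finite A" "p dvd (\<Prod>x\<in>A. f x)"
  shows "\<exists>x\<in>A. p dvd f x"
  using assms(2,3,1)
  by (induction A rule: finite_induct) (auto dest: prime_elem_dvd_multD simp: prime_elem_def)

text \<open>Suppose a square divides \<open>p * \<Prod>A\<close>. Either \<open>p\<close> divides
  its root, and cancelling makes \<open>p\<close> divide \<open>\<Prod>A\<close>, or
  \<open>p\<close> divides the cofactor, and cancelling leaves the square dividing
  \<open>\<Prod>A\<close>.\<close>

lemma squarefree_prod_primes:
  fixes A :: "'r::idom set"
  assumes "finite A" "\<And>p. p \<in> A \<Longrightarrow> prime_elem p"
    and "\<And>p r. p \<in> A \<Longrightarrow> r \<in> A \<Longrightarrow> p dvd r \<Longrightarrow> p = r"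
  shows "squarefree (\<Prod>A)"
  using assms
proof (induction A rule: finite_induct)
  case (insert p A)
  have p: "prime_elem p" "p \<noteq> 0" using insert.prems(1)[of p] by auto
  have ndvd: "\<not> p dvd \<Prod>A"
    using prime_elem_dvd_prod[OF p(1) insert.hyps(1), of "\<lambda>x. x"] insert by auto
  show ?case
  proof (rule squarefreeI)
    fix x assume "x\<^sup>2 dvd \<Prod>(insert p A)"
    then obtain y where y: "p * \<Prod>A = x\<^sup>2 * y" using insert.hyps by (auto elim: dvdE)
    show "x dvd 1"
    proof (cases "p dvd x")
      case True
      then obtain z where "x = p * z" by blast
      hence "p * \<Prod>A = p * (p * (z\<^sup>2 * y))" using y by (simp add: power2_eq_square mult_ac)
      hence "\<Prod>A = p * (z\<^sup>2 * y)" using p(2) by simp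
      thus ?thesis using ndvd by simp
    next
      case False
      have "p dvd x\<^sup>2 * y" using y by (metis dvd_triv_left)
      hence "p dvd y" using False p(1) by (metis prime_elem_dvd_multD prime_elem_dvd_power)
      then obtain z where "y = p * z" by blast
      hence "p * \<Prod>A = p * (x\<^sup>2 * z)" using y by (simp add: mult_ac)
      hence "x\<^sup>2 dvd \<Prod>A" using p(2) by simp
      thus ?thesis using insert.IH insert.prems squarefreeD by blast
    qed
  qed
qed (auto simp: squarefree_def power2_eq_square dest: dvd_mult_left)

text \<open>Each subset of \<open>A\<close> contributes its product, a monic squarefree divisor; the
  members of \<open>A\<close> dividing the product recover the subset.\<close>

lemma two_power_card_primes_le_W_q:
  fixes f :: "'q::finite_field poly"
  assumes "f \<noteq> 0" "finite A"
    and A: "\<And>p. p \<in> A \<Longrightarrow> prime_elem p \<and> lead_coeff p = 1 \<and> p dvd f"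
    and eq: "\<And>p r. p \<in> A \<Longrightarrow> r \<in> A \<Longrightarrow> p dvd r \<Longrightarrow> p = r"
  shows "2 ^ card A \<le> W_q f"
proof -
  let ?D = "{g. lead_coeff g = 1 \<and> squarefree g \<and> g dvd f}"
  have "?D \<subseteq> {g. degree g \<le> degree f}" using assms(1) by (auto intro: dvd_imp_degree_le)
  hence fin: "finite ?D" using finite_polys_degree_le finite_subset by blast
  have mem: "\<Prod>S \<in> ?D" if S: "S \<subseteq> A" for S
  proof -
    have finS: "finite S" using S assms(2) finite_subset by blast
    have "lead_coeff (\<Prod>S) = (\<Prod>p\<in>S. lead_coeff p)" by (simp add: lead_coeff_prod)
    also have "\<dots> = 1" using S A by (intro prod.neutral) auto
    finally have "lead_coeff (\<Prod>S) = 1" .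
    moreover have "squarefree (\<Prod>S)" using S A eq finS by (intro squarefree_prod_primes) blast+
    moreover have "\<Prod>S dvd f"
      using finS S
    proof (induction S rule: finite_induct)
      case (insert p S)
      then obtain c where c: "f = \<Prod>S * c" by auto
      have p: "prime_elem p" "p dvd f" using A insert by auto
      have "\<not> p dvd \<Prod>S"
        using prime_elem_dvd_prod[OF p(1) insert.hyps(1), of "\<lambda>x. x"] insert eq by blast
      hence "p dvd c" using p c prime_elem_dvd_multD by metis
      thus ?case using insert.hyps by (auto simp: c mult.commute)
    qed simp
    ultimately show ?thesis by blast
  qed
  have "inj_on Prod (Pow A)"
  proof -
    have sub: "S \<subseteq> T" if ST: "S \<in> Pow A" "T \<in> Pow A" "\<Prod>S = \<Prod>T" for S T
    proof
      fix p assume p: "p \<in> S"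
      have fins: "finite S" "finite T" using ST assms(2) finite_subset by auto
      have "p dvd \<Prod>T" unfolding ST(3)[symmetric] using p fins by (metis dvd_prodI)
      then obtain r where "r \<in> T" "p dvd r"
        using prime_elem_dvd_prod[of p T "\<lambda>x. x"] A p ST fins by blast
      thus "p \<in> T" using eq p ST by blast
    qed
    show ?thesis by (intro inj_onI equalityI sub) auto
  qed
  hence "card (Pow A) \<le> card ?D" using mem fin by (intro card_inj_on_le[of Prod]) auto
  thus ?thesis by (simp add: W_q_def card_Pow assms(2))
qed

locale finite_field_extension =
  fixes \<phi> :: "'q::finite_field \<Rightarrow> 'a::finite_field" and q n :: nat
  assumes emb: "field_embedding \<phi>" and q: "primepow q" "CARD('q) = q"
    and card: "CARD('a) = q ^ n" and n: "n > 0"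
begin

lemma q_gt_1: "q > 1" using primepow_gt_Suc_0[OF q(1)] by simp

lemma phi_simps [simp]:
  "\<phi> 1 = 1" "\<phi> (x + y) = \<phi> x + \<phi> y" "\<phi> (x * y) = \<phi> x * \<phi> y"
  using emb by (auto simp: field_embedding_def)

lemma phi_0 [simp]: "\<phi> 0 = 0" using phi_simps(2)[of 0 0] by (metis add_cancel_right_right add_0)

lemma phi_diff [simp]: "\<phi> (x - y) = \<phi> x - \<phi> y"
  using phi_simps(2)[of "x - y" y] by (simp add: algebra_simps)

lemma phi_eq_0_iff [simp]: "\<phi> x = 0 \<longleftrightarrow> x = 0"
proof
  assume "\<phi> x = 0"
  hence "\<phi> (x * inverse x) = 0" by (simp only: phi_simps mult_zero_left)
  thus "x = 0" by (cases "x = 0") auto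
qed simp

lemma phi_power: "\<phi> x ^ k = \<phi> (x ^ k)" by (induction k) auto

lemma phi_frobenius [simp]: "\<phi> c ^ q = \<phi> c"
  using finite_field_power_card_eq_same[of c] by (simp add: phi_power q(2))

lemma q_eq_CHAR_power: "\<exists>m. q = CHAR('a) ^ m"
proof -
  obtain r m where r: "prime r" "m > 0" "q = r ^ m"
    using q(1) by (auto simp: primepow_def)
  have "CHAR('a) dvd r ^ (m * n)" using CHAR_dvd_CARD[where 'a='a] card r(3) by (simp add: power_mult)
  hence "CHAR('a) = r" using r(1) by (metis prime_CHAR_semidom CHAR_pos prime_dvd_power primes_dvd_imp_eq)
  thus ?thesis using r by auto
qed

lemma frobenius_add: "(x + y :: 'a) ^ q = x ^ q + y ^ q"
  using q_eq_CHAR_power freshmans_dream'[of q _ x y] by auto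

lemma frobenius_sum: "(\<Sum>i\<in>A. f i :: 'a) ^ q = (\<Sum>i\<in>A. f i ^ q)"
  using q_eq_CHAR_power freshmans_dream_sum'[of q _ f A] by auto

text \<open>\<open>lin f\<close> is \<open>f\<close> evaluated at the Frobenius map \<open>x \<mapsto> x ^ q\<close>.\<close>
definition lin :: "'q poly \<Rightarrow> 'a \<Rightarrow> 'a" where
  "lin f x = (\<Sum>i\<le>degree f. \<phi> (coeff f i) * x ^ (q ^ i))"

lemma lin_altdef: "degree f \<le> m \<Longrightarrow> lin f x = (\<Sum>i\<le>m. \<phi> (coeff f i) * x ^ (q ^ i))"
  unfolding lin_def by (intro sum.mono_neutral_left) (auto simp: coeff_eq_0)

lemma lin_0 [simp]: "lin 0 x = 0" by (simp add: lin_def)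

text \<open>Horner's rule: coefficients from the base field are fixed by Frobenius, which therefore
  passes through the sum. It drives the inductions on polynomials below.\<close>

lemma lin_pCons: "lin (pCons c f) x = \<phi> c * x + lin f x ^ q"
proof -
  have "lin (pCons c f) x = (\<Sum>i\<le>Suc (degree f). \<phi> (coeff (pCons c f) i) * x ^ (q ^ i))"
    by (rule lin_altdef) (rule degree_pCons_le)
  also have "\<dots> = \<phi> c * x + (\<Sum>i\<le>degree f. \<phi> (coeff f i) * x ^ (q ^ Suc i))"
    by (subst sum.atMost_Suc_shift) simp
  also have "(\<Sum>i\<le>degree f. \<phi> (coeff f i) * x ^ (q ^ Suc i)) = lin f x ^ q"
    by (simp add: lin_def frobenius_sum power_mult_distrib power_mult[symmetric] mult.commute)
  finally show ?thesis .
qed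

lemma lin_add: "lin (f + g) x = lin f x + lin g x"
proof -
  let ?m = "max (degree f) (degree g)"
  have "degree (f + g) \<le> ?m" by (rule degree_add_le_max)
  thus ?thesis by (simp add: lin_altdef[of _ ?m] sum.distrib distrib_right)
qed

lemma lin_diff: "lin (f - g) x = lin f x - lin g x"
  using lin_add[of "f - g" g x] by (simp add: algebra_simps)

lemma lin_smult: "lin (smult c f) x = \<phi> c * lin f x"
  by (simp add: lin_altdef[of "smult c f" "degree f"] degree_smult_le lin_def sum_distrib_left mult.assoc)

text \<open>With additivity, this makes \<open>'a\<close> a module over \<open>'q poly\<close> with
  X acting as Frobenius; in particular all maps \<open>lin f\<close> commute.\<close>

lemma lin_mult: "lin (f * g) x = lin f (lin g x)"
  by (induction f) (simp_all add: lin_add lin_smult lin_pCons)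

lemma lin_1 [simp]: "lin 1 x = x" by (simp add: lin_def)

lemma lin_zero_right [simp]: "lin f 0 = 0"
  using q_gt_1 by (simp add: lin_def power_0_left)

lemma lin_add_right: "lin f (x + y) = lin f x + lin f y"
  by (induction f) (simp_all add: lin_pCons frobenius_add algebra_simps)

lemma lin_sum_right: "lin f (\<Sum>i\<in>A. g i) = (\<Sum>i\<in>A. lin f (g i))"
  by (induction A rule: infinite_finite_induct) (auto simp: lin_add_right)

lemma lin_X_power: "lin ([:0, 1:] ^ k) x = x ^ (q ^ k)"
  by (induction k) (simp_all add: lin_pCons power_mult[symmetric] mult.commute)

lemma lin_X_power_n_minus_1: "lin ([:0, 1:] ^ n - 1) x = 0"
  using finite_field_power_card_eq_same[of x] by (simp add: lin_diff lin_X_power card)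

lemma X_power_n_minus_1_nonzero: "([:0, 1:] ^ n - 1 :: 'q poly) \<noteq> 0"
proof
  assume "([:0, 1:] ^ n - 1 :: 'q poly) = 0"
  hence "poly ([:0, 1:] ^ n - 1 :: 'q poly) 0 = 0" by simp
  thus False using n by (simp add: power_0_left)
qed

section \<open>Annihilators and kernels in the Frobenius module\<close>

lemma card_kernel_lin_le:
  assumes "P \<noteq> 0"
  shows "card {x. lin P x = 0} \<le> q ^ degree P"
proof -
  \<comment> \<open>The linearized polynomial of \<open>P\<close>: its exponents
    \<open>q ^ i\<close> are distinct, so the leading coefficient of \<open>P\<close>
    survives.\<close>
  define Q where "Q = (\<Sum>i\<le>degree P. monom (\<phi> (coeff P i)) (q ^ i))"
  have poly_Q: "poly Q x = lin P x" for x by (simp add: Q_def lin_def poly_sum poly_monom)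
  have "coeff Q (q ^ degree P) = (\<Sum>i\<le>degree P. if i = degree P then \<phi> (coeff P i) else 0)"
    unfolding Q_def coeff_sum using q_gt_1 by (intro sum.cong) (auto simp: power_inject_exp)
  also have "\<dots> = \<phi> (lead_coeff P)" by simp
  finally have "Q \<noteq> 0" using assms by auto
  have "degree Q \<le> q ^ degree P" unfolding Q_def using q_gt_1
    by (intro degree_sum_le) (auto intro!: order.trans[OF degree_monom_le] power_increasing)
  thus ?thesis using card_poly_roots_bound[OF \<open>Q \<noteq> 0\<close>] by (simp add: poly_Q)
qed

text \<open>The remainder of \<open>h\<close> modulo \<open>D\<close> also annihilates
  \<open>b\<close>, and its degree is too small unless it is 0.\<close>

lemma dvd_of_minimal_annihilator:
  assumes "D \<noteq> 0" "lin D b = 0" "lin h b = 0"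
    and min: "\<And>g. g \<noteq> 0 \<Longrightarrow> lin g b = 0 \<Longrightarrow> degree D \<le> degree g"
  shows "D dvd h"
proof -
  have "lin (h mod D) b = 0"
  proof -
    have "lin (h div D * D + h mod D) b = 0" using assms(3) by simp
    thus ?thesis by (simp only: lin_add lin_mult assms(2) lin_zero_right add_0_left)
  qed
  hence "h mod D = 0"
    using min[of "h mod D"] degree_mod_less[OF assms(1), of h] by linarith
  thus ?thesis by auto
qed

text \<open>The annihilator of \<open>b\<close> is generated by an element \<open>D\<close> of
  minimal degree. \<open>D\<close> is no unit as \<open>b \<noteq> 0\<close>, so it is associated to
  \<open>P\<close>.\<close>

lemma irreducible_annihilator_dvd:
  assumes P: "irreducible P" and b: "b \<noteq> 0" "lin P b = 0" and f: "lin f b = 0"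
  shows "P dvd f"
proof -
  define S where "S = (\<lambda>g. g \<noteq> 0 \<and> lin g b = 0)"
  have "S P" using P b by (auto simp: S_def)
  then obtain D where D: "S D" "\<And>g. S g \<Longrightarrow> degree D \<le> degree g"
    using arg_min_natI[of S P degree] arg_min_nat_le[of S _ degree] by metis
  have dvd: "D dvd h" if "lin h b = 0" for h
    using D that by (intro dvd_of_minimal_annihilator[of D b]) (auto simp: S_def)
  obtain c where c: "P = D * c" using dvd[OF b(2)] by blast
  have "\<not> D dvd 1"
  proof
    assume "D dvd 1"
    then obtain u where "1 = u * D" by (metis dvdE mult.commute)
    hence "lin 1 b = lin u (lin D b)" by (metis lin_mult)
    thus False using D b by (simp add: S_def)
  qed
  hence "c dvd 1" using irreducibleD[OF P c] by blast
  hence "P dvd D" unfolding c by (simp add: mult_unit_dvd_iff)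
  thus ?thesis using dvd[OF f] dvd_trans by blast
qed

text \<open>Every irreducible factor of \<open>X ^ n - 1\<close> has a nontrivial kernel; taking this as a condition makes the
  proof of that fact unnecessary and gives primality of the factors without unique factorization.\<close>
definition simple_factors :: "'q poly set" where
  "simple_factors = {P. lead_coeff P = 1 \<and> irreducible P \<and> P dvd [:0, 1:] ^ n - 1 \<and>
     (\<exists>b. b \<noteq> 0 \<and> lin P b = 0)}"

lemma finite_simple_factors: "finite simple_factors"
proof (rule finite_subset)
  show "simple_factors \<subseteq> {g. degree g \<le> degree ([:0, 1:] ^ n - 1 :: 'q poly)}"
    using X_power_n_minus_1_nonzero by (auto simp: simple_factors_def intro: dvd_imp_degree_le)
qed (rule finite_polys_degree_le)

text \<open>Take \<open>b \<noteq> 0\<close> in the kernel of \<open>P\<close> and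
  \<open>P dvd f * g\<close>. If \<open>lin g b = 0\<close>, then \<open>P dvd g\<close>; otherwise
  \<open>lin g b\<close> is a nonzero element of the same kernel that \<open>f\<close> kills, so
  \<open>P dvd f\<close>.\<close>

lemma prime_elem_simple_factor:
  assumes "P \<in> simple_factors"
  shows "prime_elem P"
proof (rule prime_elemI)
  have P: "irreducible P" using assms by (simp add: simple_factors_def)
  obtain b where b: "b \<noteq> 0" "lin P b = 0" using assms by (auto simp: simple_factors_def)
  show "P \<noteq> 0" "\<not> P dvd 1" using P by (auto simp: irreducible_def)
  fix f g assume "P dvd f * g"
  then obtain c where "f * g = c * P" by (metis dvdE mult.commute)
  hence fg: "lin f (lin g b) = 0" by (metis lin_mult b(2) lin_zero_right)
  show "P dvd f \<or> P dvd g"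
  proof (cases "lin g b = 0")
    case True
    thus ?thesis using irreducible_annihilator_dvd[OF P b] by blast
  next
    case False
    moreover have "lin P (lin g b) = lin g (lin P b)" by (metis lin_mult mult.commute)
    ultimately show ?thesis using irreducible_annihilator_dvd[OF P False _ fg] b by simp
  qed
qed

lemma simple_factor_dvd_imp_eq:
  "P \<in> simple_factors \<Longrightarrow> Q \<in> simple_factors \<Longrightarrow> P dvd Q \<Longrightarrow> P = Q"
  by (rule monic_irreducible_dvd_imp_eq) (auto simp: simple_factors_def)

lemma two_power_card_simple_factors_le: "2 ^ card simple_factors \<le> W_q ([:0, 1:] ^ n - 1 :: 'q poly)"
  using X_power_n_minus_1_nonzero finite_simple_factors prime_elem_simple_factor simple_factor_dvd_imp_eq
  by (intro two_power_card_primes_le_W_q) (auto simp: simple_factors_def)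

text \<open>The product \<open>R\<close> of the other factors kills every summand except
  \<open>t P\<close>, hence also \<open>t P\<close>. Were \<open>t P \<noteq> 0\<close>,
  \<open>P\<close> would divide \<open>R\<close> and so equal another factor.\<close>

lemma kernels_independent:
  assumes t: "\<And>P. P \<in> simple_factors \<Longrightarrow> lin P (t P) = 0"
    and sum: "(\<Sum>P\<in>simple_factors. t P) = 0" and P: "P \<in> simple_factors"
  shows "t P = 0"
proof (rule ccontr)
  assume nz: "t P \<noteq> 0"
  define R where "R = \<Prod>(simple_factors - {P})"
  have "lin R (t Q) = 0" if "Q \<in> simple_factors - {P}" for Q
  proof -
    have "R = \<Prod>(simple_factors - {P} - {Q}) * Q"
      unfolding R_def using that finite_simple_factors by (subst prod.remove[of _ Q]) (auto simp: mult.commute)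
    thus ?thesis using t that by (simp add: lin_mult)
  qed
  hence "(\<Sum>Q\<in>simple_factors. lin R (t Q)) = lin R (t P)"
    using finite_simple_factors P by (subst sum.remove[of _ P]) auto
  hence "lin R (t P) = 0" by (simp add: lin_sum_right[symmetric] sum)
  hence "P dvd R"
    using irreducible_annihilator_dvd[of P "t P" R] P t nz by (auto simp: simple_factors_def)
  then obtain Q where "Q \<in> simple_factors - {P}" "P dvd Q"
    using prime_elem_dvd_prod[OF prime_elem_simple_factor[OF P], of "simple_factors - {P}" "\<lambda>x. x"]
      finite_simple_factors unfolding R_def by blast
  thus False using simple_factor_dvd_imp_eq[OF P] by blast
qed

section \<open>Normal elements\<close>

lemma card_span_le:
  assumes "finite S"
  shows "card (module.span (\<lambda>c x. \<phi> c * x) S) \<le> q ^ card S"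
proof -
  interpret V: vector_space "\<lambda>c x. \<phi> c * x" by (rule vector_space_field_embedding[OF emb])
  have "V.span S \<subseteq> (\<lambda>u. \<Sum>v\<in>S. \<phi> (u v) * v) ` (S \<rightarrow>\<^sub>E UNIV)"
  proof
    fix x assume "x \<in> V.span S"
    then obtain u where "x = (\<Sum>v\<in>S. \<phi> (u v) * v)" using V.span_finite[OF assms] by auto
    thus "x \<in> (\<lambda>u. \<Sum>v\<in>S. \<phi> (u v) * v) ` (S \<rightarrow>\<^sub>E UNIV)"
      by (intro image_eqI[of _ _ "restrict u S"]) auto
  qed
  hence "card (V.span S) \<le> card (S \<rightarrow>\<^sub>E (UNIV :: 'q set))"
    using assms by (intro surj_card_le) (auto intro: finite_PiE)
  thus ?thesis using assms by (simp add: card_PiE q(2))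
qed

text \<open>Spanning forces independence by counting: if the conjugates were dependent, fewer than
  \<open>n\<close> of them would span all \<open>q ^ n\<close> elements.\<close>

lemma normal_overI_span:
  assumes "module.span (\<lambda>c x. \<phi> c * x) {\<alpha> ^ (q ^ i) | i. i < n} = UNIV"
  shows "normal_over \<phi> n \<alpha>"
proof -
  interpret V: vector_space "\<lambda>c x. \<phi> c * x" by (rule vector_space_field_embedding[OF emb])
  define B where "B = {\<alpha> ^ (q ^ i) | i. i < n}"
  have B: "B = (\<lambda>i. \<alpha> ^ (q ^ i)) ` {..<n}" by (auto simp: B_def)
  have cardB: "card B \<le> n" unfolding B using card_image_le[of "{..<n}"] by simp
  have "\<not> V.dependent B"
  proof
    assume "V.dependent B"
    then obtain v where v: "v \<in> B" "v \<in> V.span (B - {v})" by (auto simp: V.dependent_def)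
    have "B \<subseteq> V.span (B - {v})" using v V.span_superset[of "B - {v}"] by blast
    hence "V.span B \<subseteq> V.span (B - {v})" by (rule V.span_minimal) (rule V.subspace_span)
    hence "V.span (B - {v}) = UNIV" using assms unfolding B_def by blast
    hence "q ^ n \<le> q ^ card (B - {v})"
      using card_span_le[of "B - {v}"] by (simp add: card)
    hence "n \<le> card (B - {v})" by (rule power_le_imp_le_exp[OF q_gt_1])
    moreover have "card (B - {v}) < card B" using v by (intro card_Diff1_less) auto
    ultimately show False using cardB by simp
  qed
  thus ?thesis using assms by (simp add: normal_over_def q(2) B_def)
qed

text \<open>If the conjugates of \<open>\<alpha>\<close> span a proper subspace, its annihilator \<open>W\<close> with respect to \<open>\<psi>\<close> is a
  nonzero module over the polynomial ring. An annihilating polynomial \<open>D\<close> of minimal degree of a nonzero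
  element of \<open>W\<close> is irreducible, and \<open>W\<close> contains the whole kernel of \<open>lin D\<close> because that kernel has at
  most \<open>q ^ degree D\<close> elements.\<close>
lemma not_normal_imp_orthogonal_kernel:
  assumes "additive_character \<psi>" and frob: "\<And>x. \<psi> (x ^ q) = \<psi> x"
    and "\<not> normal_over \<phi> n \<alpha>"
  shows "\<exists>P\<in>simple_factors. \<forall>b. lin P b = 0 \<longrightarrow> \<psi> (b * \<alpha>) = 1"
proof -
  interpret additive_character \<psi> by fact
  interpret V: vector_space "\<lambda>c x. \<phi> c * x" by (rule vector_space_field_embedding[OF emb])
  define B where "B = {\<alpha> ^ (q ^ i) | i. i < n}"
  define V where "V = V.span B"
  have "V \<noteq> UNIV" using assms(3) normal_overI_span by (auto simp: V_def B_def)
  \<comment> \<open>Frobenius sends each conjugate of \<open>\<alpha>\<close> to the next, and the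
    last one wraps around since \<open>\<alpha> ^ (q ^ n) = \<alpha>\<close>.\<close>
  have V_frob: "x ^ q \<in> V" if "x \<in> V" for x
  proof -
    have "V.subspace {x. x ^ q \<in> V}"
    proof (rule V.subspaceI)
      show "0 \<in> {x. x ^ q \<in> V}" using q_gt_1 V.span_zero by (simp add: V_def power_0_left)
      show "x + y \<in> {x. x ^ q \<in> V}" if "x \<in> {x. x ^ q \<in> V}" "y \<in> {x. x ^ q \<in> V}" for x y
        using that V.span_add by (simp add: V_def frobenius_add)
      show "\<phi> c * x \<in> {x. x ^ q \<in> V}" if "x \<in> {x. x ^ q \<in> V}" for c x
        using that V.span_scale by (simp add: V_def power_mult_distrib)
    qed
    moreover have "B \<subseteq> {x. x ^ q \<in> V}"
    proof
      fix x assume "x \<in> B"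
      then obtain i where i: "x = \<alpha> ^ (q ^ i)" "i < n" by (auto simp: B_def)
      have x: "x ^ q = \<alpha> ^ (q ^ Suc i)" by (simp add: i(1) power_mult[symmetric] mult.commute)
      have "x ^ q \<in> B"
      proof (cases "Suc i = n")
        case True
        hence "x ^ q = \<alpha> ^ (q ^ 0)" using x finite_field_power_card_eq_same[of \<alpha>] card by simp
        thus ?thesis unfolding B_def using n by blast
      next
        case False
        thus ?thesis using x i(2) unfolding B_def by (metis (mono_tags, lifting) Suc_lessI mem_Collect_eq)
      qed
      thus "x \<in> {x. x ^ q \<in> V}" by (simp add: V_def V.span_base)
    qed
    ultimately have "V \<subseteq> {x. x ^ q \<in> V}" unfolding V_def using V.span_minimal by blast
    thus ?thesis using that by blast
  qed
  have V_frob_pow: "x ^ (q ^ k) \<in> V" if "x \<in> V" for x k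
    by (induction k) (use that V_frob in \<open>auto simp: power_mult mult.commute[of q]\<close>)
  define W where "W = {b. \<forall>x\<in>V. \<psi> (b * x) = 1}"
  have W_add: "x + y \<in> W" if "x \<in> W" "y \<in> W" for x y
    using that by (simp add: W_def distrib_right add)
  have W_scale: "\<phi> c * x \<in> W" if "x \<in> W" for c x
  proof -
    have "\<psi> (x * (\<phi> c * v)) = 1" if "v \<in> V" for v
      using that \<open>x \<in> W\<close> V.span_scale by (auto simp: W_def V_def)
    thus ?thesis by (simp add: W_def mult_ac)
  qed
  have W_frob: "b ^ q \<in> W" if b: "b \<in> W" for b
  proof -
    have "\<psi> (b ^ q * x) = 1" if x: "x \<in> V" for x
    proof -
      \<comment> \<open>\<open>y\<close> is the preimage of \<open>x\<close> under Frobenius and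
        lies in \<open>V\<close>; invariance of \<open>\<psi>\<close> replaces
        \<open>b ^ q * x = (b * y) ^ q\<close> by \<open>b * y\<close>.\<close>
      define y where "y = x ^ (q ^ (n - 1))"
      have "y ^ q = x ^ (q ^ Suc (n - 1))" by (simp add: y_def power_mult[symmetric] mult.commute)
      hence "y ^ q = x" using n finite_field_power_card_eq_same[of x] card by simp
      hence "\<psi> (b ^ q * x) = \<psi> (b * y)" by (metis frob power_mult_distrib)
      thus ?thesis using b V_frob_pow[OF x] by (simp add: W_def y_def)
    qed
    thus ?thesis by (simp add: W_def)
  qed
  have "0 \<in> W" by (simp add: W_def zero)
  hence W_lin: "lin f b \<in> W" if "b \<in> W" for f b
    using that by (induction f) (auto simp: lin_pCons W_add W_scale W_frob)
  \<comment> \<open>The minimum is taken over all nonzero elements of \<open>W\<close> at once, so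
    that it also applies to \<open>lin g b\<close> in the proof of irreducibility.\<close>
  define S where "S = (\<lambda>D. D \<noteq> 0 \<and> (\<exists>b\<in>W. b \<noteq> 0 \<and> lin D b = 0))"
  have "\<exists>b. b \<noteq> 0 \<and> (\<forall>x\<in>V. \<psi> (b * x) = 1)"
    using \<open>V \<noteq> UNIV\<close> by (intro ex_orthogonal) (auto simp: V_def V.span_diff V.span_zero)
  hence "S ([:0, 1:] ^ n - 1)"
    using X_power_n_minus_1_nonzero lin_X_power_n_minus_1 by (auto simp: S_def W_def)
  then obtain D' where D': "S D'" "\<And>g. S g \<Longrightarrow> degree D' \<le> degree g"
    using arg_min_natI[of S _ degree] arg_min_nat_le[of S _ degree] by metis
  define D where "D = smult (inverse (lead_coeff D')) D'"
  have lc: "lead_coeff D' \<noteq> 0" using D' by (auto simp: S_def)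
  have D: "D \<noteq> 0" "lead_coeff D = 1" "degree D = degree D'" using lc by (auto simp: D_def)
  obtain b where b: "b \<in> W" "b \<noteq> 0" "lin D b = 0"
    using D'(1) by (auto simp: S_def D_def lin_smult)
  have min: "degree D \<le> degree g" if "g \<noteq> 0" "x \<in> W" "x \<noteq> 0" "lin g x = 0" for g x
    using D'(2)[of g] that D(3) by (auto simp: S_def)
  have deg_pos: "degree D > 0"
  proof (rule ccontr)
    assume "\<not> ?thesis"
    hence "D = 1" using D(2) by (metis degree_0_id not_gr_zero one_pCons)
    thus False using b by simp
  qed
  have "irreducible D"
  proof (rule irreducibleI)
    show "D \<noteq> 0" by fact
    show "\<not> D dvd 1" using deg_pos by (auto simp: is_unit_poly_iff)
    fix f g assume fg: "D = f * g"
    hence nz: "f \<noteq> 0" "g \<noteq> 0" using D(1) by auto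
    hence deg: "degree D = degree f + degree g" by (simp add: fg degree_mult_eq)
    have "degree f = 0 \<or> degree g = 0"
    proof (cases "lin g b = 0")
      case True
      thus ?thesis using min[OF nz(2) b(1,2)] deg by simp
    next
      case False
      moreover have "lin f (lin g b) = 0" using b(3) by (simp add: fg lin_mult)
      ultimately show ?thesis using min[OF nz(1) W_lin[OF b(1)] False] deg by simp
    qed
    thus "f dvd 1 \<or> g dvd 1" using nz by (metis is_unit_iff_degree)
  qed
  moreover have "D dvd [:0, 1:] ^ n - 1"
    using D(1) b min lin_X_power_n_minus_1 by (intro dvd_of_minimal_annihilator[of D b]) auto
  ultimately have "D \<in> simple_factors" using D(2) b by (auto simp: simple_factors_def)
  \<comment> \<open>\<open>X\<close> encodes the polynomials of degree below \<open>degree D\<close>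
    as coefficient lists of fixed length. By minimality they act injectively on \<open>b\<close>,
    giving \<open>q ^ degree D\<close> kernel elements, all in \<open>W\<close>.\<close>
  define X where "X = {xs :: 'q list. set xs \<subseteq> UNIV \<and> length xs = degree D}"
  have "inj_on (\<lambda>xs. lin (Poly xs) b) X"
  proof
    fix xs ys assume xy: "xs \<in> X" "ys \<in> X" "lin (Poly xs) b = lin (Poly ys) b"
    have "degree (Poly zs) \<le> degree D - 1" if "zs \<in> X" for zs
      using that by (intro degree_le) (auto simp: X_def nth_default_def)
    hence "degree (Poly xs - Poly ys) \<le> degree D - 1" using xy by (intro degree_diff_le) auto
    hence "degree (Poly xs - Poly ys) < degree D" using deg_pos by linarith
    moreover have "lin (Poly xs - Poly ys) b = 0" using xy by (simp add: lin_diff)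
    ultimately have "Poly xs = Poly ys" using min[OF _ b(1,2)] by (metis not_le right_minus_eq)
    hence "coeff (Poly xs) i = coeff (Poly ys) i" for i by simp
    hence "nth_default 0 xs i = nth_default 0 ys i" for i by simp
    thus "xs = ys" using xy by (intro nth_equalityI) (auto simp: X_def nth_default_def split: if_splits, metis)
  qed
  hence "card ((\<lambda>xs. lin (Poly xs) b) ` X) = q ^ degree D"
    using card_lists_length_eq[of "UNIV :: 'q set" "degree D"] by (simp add: card_image X_def q(2))
  moreover have sub: "(\<lambda>xs. lin (Poly xs) b) ` X \<subseteq> {x. lin D x = 0}"
  proof clarify
    fix xs
    have "lin D (lin (Poly xs) b) = lin (Poly xs) (lin D b)" by (metis lin_mult mult.commute)
    thus "lin D (lin (Poly xs) b) = 0" using b by simp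
  qed
  ultimately have "(\<lambda>xs. lin (Poly xs) b) ` X = {x. lin D x = 0}"
    using card_kernel_lin_le[OF D(1)] by (intro card_seteq) auto
  moreover have "(\<lambda>xs. lin (Poly xs) b) ` X \<subseteq> W" using W_lin[OF b(1)] by blast
  ultimately have "{x. lin D x = 0} \<subseteq> W" by simp
  moreover have "\<alpha> ^ (q ^ 0) \<in> B" unfolding B_def using n by blast
  hence "\<alpha> \<in> V" by (simp add: V_def V.span_base)
  ultimately show ?thesis using \<open>D \<in> simple_factors\<close> by (auto simp: W_def)
qed

section \<open>Character sum estimate for normal elements in a coset\<close>

lemma ex_normal_in_coset:
  assumes H: "H \<noteq> {}" "0 \<notin> H" "\<And>x y. x \<in> H \<Longrightarrow> y \<in> H \<Longrightarrow> x * y \<in> H" and "c \<noteq> 0"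
    and large: "real (card H) \<ge> real (W_q ([:0, 1:] ^ n - 1 :: 'q poly)) * sqrt CARD('a)"
  shows "\<exists>h\<in>H. normal_over \<phi> n (c * h)"
proof (rule ccontr)
  assume none: "\<not> ?thesis"
  obtain \<psi> :: "'a \<Rightarrow> complex" where \<psi>: "additive_character \<psi>" "\<And>x. \<psi> (x ^ q) = \<psi> x"
    using ex_frobenius_invariant_character[OF card q(1)] by blast
  interpret additive_character \<psi> by fact
  define I where "I = simple_factors"
  define U where "U = (\<lambda>P. {b. lin P b = 0})"
  \<comment> \<open>The Fourier coefficients of the factor belonging to \<open>P\<close>; only the
    one at 0 is positive.\<close>
  define w where "w = (\<lambda>P (b::'a). (if b = 0 then 1 else 0) - 1 / real (card (U P)))"
  define \<Theta> where "\<Theta> = (\<Prod>P\<in>I. w P 0)"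
  define T where "T = (\<Pi>\<^sub>E P\<in>I. U P)"
  define t0 where "t0 = (\<lambda>P\<in>I. 0 :: 'a)"
  define S where "S = (\<lambda>t. \<Sum>h\<in>H. \<psi> ((\<Sum>P\<in>I. t P) * (c * h)))"
  have finI: "finite I" using finite_simple_factors by (simp add: I_def)
  have finT: "finite T" unfolding T_def using finI by (intro finite_PiE) auto
  have zeroU: "0 \<in> U P" for P by (simp add: U_def)
  have cardU: "card (U P) \<ge> 2" if P: "P \<in> I" for P
  proof -
    obtain b where "b \<noteq> 0" "lin P b = 0" using P by (auto simp: I_def simple_factors_def)
    hence "card {0, b} = 2" "{0, b} \<subseteq> U P" by (auto simp: U_def)
    thus ?thesis using card_mono[of "U P" "{0, b}"] by simp
  qed
  have w0: "w P 0 > 0" if "P \<in> I" for P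
    using cardU[OF that] by (simp add: w_def)
  have sum_w: "(\<Sum>b\<in>U P. w P b) = 0" if "P \<in> I" for P
  proof -
    have "(\<Sum>b\<in>U P. if b = 0 then 1 else 0 :: real) = 1" using zeroU[of P] by (subst sum.delta) auto
    moreover have "card (U P) \<noteq> 0" using cardU[OF that] by linarith
    ultimately show ?thesis unfolding w_def sum_subtractf by simp
  qed
  \<comment> \<open>As the coefficients sum to 0, the negative ones have total absolute value
    \<open>w P 0\<close> as well.\<close>
  have sum_abs_w: "(\<Sum>b\<in>U P. \<bar>w P b\<bar>) = 2 * w P 0" if "P \<in> I" for P
  proof -
    have "\<bar>w P b\<bar> = (if b = 0 then 2 * w P 0 else 0) - w P b" for b
      using w0[OF that] by (cases "b = 0") (simp_all add: w_def)
    hence "(\<Sum>b\<in>U P. \<bar>w P b\<bar>) = (\<Sum>b\<in>U P. if b = 0 then 2 * w P 0 else 0) - (\<Sum>b\<in>U P. w P b)"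
      by (simp only: sum_subtractf)
    also have "(\<Sum>b\<in>U P. if b = 0 then 2 * w P 0 else 0) = 2 * w P 0"
      using zeroU[of P] by (subst sum.delta) auto
    finally show ?thesis using sum_w[OF that] by simp
  qed
  \<comment> \<open>If \<open>c * h\<close> is not normal, some kernel \<open>U P\<close> is
    orthogonal to it, and the factor of that \<open>P\<close> collapses to the sum of its
    coefficients, which is 0.\<close>
  have vanish: "(\<Prod>P\<in>I. \<Sum>b\<in>U P. of_real (w P b) * \<psi> (b * (c * h))) = 0" if "h \<in> H" for h
  proof -
    have "\<not> normal_over \<phi> n (c * h)" using none that by blast
    from not_normal_imp_orthogonal_kernel[OF \<psi> this] obtain P
      where P: "P \<in> I" "\<And>b. b \<in> U P \<Longrightarrow> \<psi> (b * (c * h)) = 1" by (auto simp: I_def U_def)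
    have "(\<Sum>b\<in>U P. of_real (w P b) * \<psi> (b * (c * h))) = of_real (\<Sum>b\<in>U P. w P b)"
      using P(2) by simp
    thus ?thesis using sum_w P(1) finI by (auto intro: prod_zero)
  qed
  have expand: "(\<Sum>t\<in>T. of_real (\<Prod>P\<in>I. w P (t P)) * S t) = 0"
  proof -
    have "(\<Sum>t\<in>T. of_real (\<Prod>P\<in>I. w P (t P)) * S t) =
        (\<Sum>h\<in>H. \<Sum>t\<in>T. of_real (\<Prod>P\<in>I. w P (t P)) * \<psi> ((\<Sum>P\<in>I. t P) * (c * h)))"
      unfolding S_def by (subst sum.swap) (simp add: sum_distrib_left)
    also have "\<dots> = (\<Sum>h\<in>H. \<Sum>t\<in>T. \<Prod>P\<in>I. of_real (w P (t P)) * \<psi> (t P * (c * h)))"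
      by (simp add: sum_distrib_right sum_eq[OF finI] prod.distrib)
    also have "\<dots> = (\<Sum>h\<in>H. \<Prod>P\<in>I. \<Sum>b\<in>U P. of_real (w P b) * \<psi> (b * (c * h)))"
      unfolding T_def using finI by (subst prod_sum_PiE) auto
    finally show ?thesis using vanish by simp
  qed
  have t0: "t0 \<in> T" using zeroU by (auto simp: t0_def T_def)
  have S_t0: "S t0 = of_nat (card H)" by (simp add: S_def t0_def zero)
  \<comment> \<open>A tuple other than \<open>t0\<close> has nonzero sum by independence of the
    kernels, so the coset bound applies.\<close>
  have S_le: "norm (S t) \<le> sqrt CARD('a)" if t: "t \<in> T - {t0}" for t
  proof -
    have "(\<Sum>P\<in>I. t P) \<noteq> 0"
    proof
      assume "(\<Sum>P\<in>I. t P) = 0"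
      hence "t P = 0" if "P \<in> I" for P
        using kernels_independent[of t P] t that by (auto simp: I_def T_def U_def)
      hence "t = t0" using t by (auto simp: t0_def T_def PiE_def extensional_def)
      thus False using t by simp
    qed
    thus ?thesis using norm_sum_coset_le[OF H, of "(\<Sum>P\<in>I. t P) * c"] \<open>c \<noteq> 0\<close>
      by (simp add: S_def mult.assoc)
  qed
  have prod_t0: "(\<Prod>P\<in>I. w P (t0 P)) = \<Theta>" by (simp add: \<Theta>_def t0_def)
  have pos: "\<Theta> > 0" unfolding \<Theta>_def using w0 by (intro prod_pos) auto
  have "(\<Sum>t\<in>T. \<Prod>P\<in>I. \<bar>w P (t P)\<bar>) = (\<Prod>P\<in>I. \<Sum>b\<in>U P. \<bar>w P b\<bar>)"
    unfolding T_def using finI by (subst prod_sum_PiE) auto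
  also have "\<dots> = 2 ^ card I * \<Theta>" using sum_abs_w by (simp add: \<Theta>_def prod.distrib)
  finally have total: "(\<Sum>t\<in>T - {t0}. \<Prod>P\<in>I. \<bar>w P (t P)\<bar>) = 2 ^ card I * \<Theta> - \<Theta>"
    using finT t0 prod_t0 pos by (simp add: sum_diff1 abs_prod[symmetric])
  define F where "F = (\<lambda>t. of_real (\<Prod>P\<in>I. w P (t P)) * S t)"
  have F_t0: "F t0 = of_real (\<Theta> * real (card H))" unfolding F_def prod_t0 S_t0 by simp
  have "F t0 + sum F (T - {t0}) = 0" using expand sum.remove[OF finT t0, of F] by (simp add: F_def)
  hence "norm (F t0) = norm (sum F (T - {t0}))" by (simp add: add_eq_0_iff norm_minus_commute)
  hence "\<Theta> * card H = norm (sum F (T - {t0}))" unfolding F_t0 norm_of_real using pos by simp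
  also have "\<dots> \<le> (\<Sum>t\<in>T - {t0}. norm (F t))" by (rule norm_sum)
  also have "\<dots> \<le> (\<Sum>t\<in>T - {t0}. (\<Prod>P\<in>I. \<bar>w P (t P)\<bar>) * sqrt CARD('a))"
  proof (rule sum_mono)
    fix t assume "t \<in> T - {t0}"
    thus "norm (F t) \<le> (\<Prod>P\<in>I. \<bar>w P (t P)\<bar>) * sqrt CARD('a)"
      unfolding F_def norm_mult norm_of_real abs_prod using S_le by (intro mult_left_mono prod_nonneg) auto
  qed
  also have "\<dots> = \<Theta> * ((2 ^ card I - 1) * sqrt CARD('a))"
    unfolding sum_distrib_right[symmetric] total by (simp add: algebra_simps)
  finally have "real (card H) \<le> (2 ^ card I - 1) * sqrt CARD('a)" using pos by simp
  \<comment> \<open>The \<open>- 1\<close> from removing \<open>t0\<close> makes the inequality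
    strict, which gives a contradiction even if the hypothesis holds with equality.\<close>
  also have "\<dots> < 2 ^ card I * sqrt CARD('a)" by simp
  also have "\<dots> \<le> real (W_q ([:0, 1:] ^ n - 1 :: 'q poly)) * sqrt CARD('a)"
  proof (intro mult_right_mono)
    have "real (2 ^ card I) \<le> real (W_q ([:0, 1:] ^ n - 1 :: 'q poly))"
      using two_power_card_simple_factors_le unfolding I_def of_nat_le_iff .
    thus "2 ^ card I \<le> real (W_q ([:0, 1:] ^ n - 1 :: 'q poly))" by simp
  qed simp
  finally show False using large by simp
qed

end

section \<open>A coset of prescribed norms and a normal element in it\<close>

theorem theorem2:
  fixes \<phi> :: "'q::finite_field \<Rightarrow> 'a::finite_field"
    and q n k :: nat and d :: "nat \<Rightarrow> nat" and a :: "nat \<Rightarrow> 'a"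
  assumes "primepow q" and "CARD('q) = q" and "CARD('a) = q ^ n" and "field_embedding \<phi>"
    and "n > 1" and "\<not> primepow n"
    and "1 < k" and "k < card {t. t dvd n}"
    and "\<And>i. i \<in> {1..k} \<Longrightarrow> d i dvd n"
    and "strict_mono_on {1..k} d" and "d k < n"
    and "\<And>i j. i \<in> {1..k} \<Longrightarrow> j \<in> {1..k} \<Longrightarrow> i \<noteq> j \<Longrightarrow> \<not> d i dvd d j"
    and "\<And>i. i \<in> {1..k} \<Longrightarrow> a i \<in> GF_sub q (d i) - {0}"
    and "\<And>i j. 1 \<le> i \<Longrightarrow> i < j \<Longrightarrow> j \<le> k \<Longrightarrow>
           ff_norm q (d i) (gcd (d i) (d j)) (a i) = ff_norm q (d j) (gcd (d i) (d j)) (a j)"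
    and "real (Gcd ((\<lambda>i. (q ^ n - 1) div (q ^ d i - 1)) ` {1..k}))
           \<ge> real (W_q ([:0, 1:] ^ n - 1 :: 'q poly)) * real q powr (real n / 2)"
  shows "\<exists>\<alpha>::'a. \<alpha> \<noteq> 0 \<and> normal_over \<phi> n \<alpha> \<and> (\<forall>i\<in>{1..k}. ff_norm q n (d i) \<alpha> = a i)"
proof -
  interpret finite_field_extension \<phi> q n using assms by unfold_locales auto
  define G where "G = Gcd ((\<lambda>i. (q ^ n - 1) div (q ^ d i - 1)) ` {1..k})"
  \<comment> \<open>\<open>G\<close> divides every norm exponent, so elements of \<open>H\<close>
    have norm 1 to each subfield and \<open>c * h\<close> has the same norms as
    \<open>c\<close>.\<close>
  define H where "H = {h::'a. h ^ G = 1}"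
  have sqrt_card: "sqrt CARD('a) = real q powr (real n / 2)"
    using q_gt_1 by (simp add: card powr_half_sqrt[symmetric] powr_powr powr_realpow[symmetric])
  have compat: "ff_norm q (d i) (gcd (d i) (d j)) (a i) = ff_norm q (d j) (gcd (d i) (d j)) (a j)"
    if "i \<in> {1..k}" "j \<in> {1..k}" for i j
    using assms(14)[of i j] assms(14)[of j i] that
    by (cases i j rule: linorder_cases) (auto simp: gcd.commute)
  obtain c :: 'a where c: "c \<noteq> 0" "\<forall>i\<in>{1..k}. ff_norm q n (d i) c = a i"
    using ex_prescribed_norms[OF card q_gt_1 n, of "{1..k}" d a] assms(9,13) compat by auto
  have G: "G dvd (q ^ n - 1) div (q ^ d i - 1)" if "i \<in> {1..k}" for i
    using that by (auto simp: G_def)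
  have one: "1 \<in> {1..k}" using assms(7) by simp
  have "(q ^ n - 1) div (q ^ d 1 - 1) dvd q ^ n - 1"
    using power_minus_1_dvd[OF assms(9)[OF one], of q] q_gt_1 by (metis dvd_div_mult_self dvd_triv_left gr0I not_one_less_zero)
  hence G_dvd: "G dvd CARD('a) - 1" using G[OF one] card dvd_trans by metis
  have "CARD('a) > 1" unfolding card using q_gt_1 n by (rule one_less_power)
  hence "G > 0" using G_dvd by (cases G) auto
  have "real (card H) \<ge> real G"
    using card_roots_of_unity_ge[OF G_dvd \<open>G > 0\<close>] by (simp add: H_def)
  hence "real (card H) \<ge> real (W_q ([:0, 1:] ^ n - 1 :: 'q poly)) * sqrt CARD('a)"
    using assms(15) unfolding sqrt_card G_def by linarith
  moreover have "1 \<in> H" by (simp add: H_def)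
  hence "H \<noteq> {}" by blast
  ultimately obtain h where h: "h \<in> H" "normal_over \<phi> n (c * h)"
    using ex_normal_in_coset[of H c] c(1) \<open>G > 0\<close> by (auto simp: H_def power_mult_distrib power_0_left)
  have "ff_norm q n (d i) (c * h) = a i" if i: "i \<in> {1..k}" for i
  proof -
    obtain s where "(q ^ n - 1) div (q ^ d i - 1) = G * s" using G[OF i] by blast
    hence "ff_norm q n (d i) h = 1" using h(1) by (simp add: ff_norm_def H_def power_mult)
    thus ?thesis using c(2) i by (simp add: ff_norm_def power_mult_distrib)
  qed
  moreover have "c * h \<noteq> 0" using c(1) h(1) \<open>G > 0\<close> by (auto simp: H_def power_0_left)
  ultimately show ?thesis using h(2) by blast
qed

end
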